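(* Let $\mathbb{K}\in\{\mathbb{R},\mathbb{C}\}$ and $A\in\mathbb{K}^{m\times n}$. Let $I=(i_1,\dots,i_t)$ be a finite nonempty list of row indices in $\{1,\dots,m\}$ and $J=(j_1,\dots,j_s)$ a finite nonempty list of column indices in $\{1,\dots,n\}$ (repetitions allowed in both). Let $C=A(:,J)$, $R=A(I,:)$ and $U=A(I,J)$. Then the following are equivalent: (i) $\operatorname{rank}(U)=\operatorname{rank}(A)$; (ii) $A=CU^\dagger R$; (iii) $A=CC^\dagger AR^\dagger R$; (iv) $A^\dagger=R^\dagger UC^\dagger$; (v) $\operatorname{rank}(C)=\operatorname{rank}(R)=\operatorname{rank}(A)$. Moreover, if any of these equivalent conditions holds, then $U^\dagger=C^\dagger AR^\dagger$.
   Context: $B^\dagger$ denotes the Moore--Penrose pseudoinverse of $B$. For index lists $I=(i_1,\dots,i_t)$ and $J=(j_1,\dots,j_s)$: $A(I,:)$ is the $t\times n$ matrix whose $a$-th row is row $i_a$ of $A$; $A(:,J)$ is the $m\times s$ matrix whose $b$-th column is column $j_b$ of $A$; $A(I,J)$ is the $t\times s$ matrix with $(a,b)$ entry $A_{i_a,j_b}$. *)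

theory Defs
  imports "HOL-Analysis.Analysis" "Jordan_Normal_Form.Conjugate"
begin

text \<open>
  The class operation \<open>conjugate\<close> is the identity on \<open>real\<close> and \<open>cnj\<close> on
  \<open>complex\<close>, so over the reals the adjoint below is the plain transpose.
\<close>

definition adjoint_matrix :: "'a::conjugatable_field^'n^'m \<Rightarrow> 'a^'m^'n" where
  "adjoint_matrix A = (\<chi> i j. conjugate (A $ j $ i))"

definition is_moore_penrose :: "'a::conjugatable_field^'n^'m \<Rightarrow> 'a^'m^'n \<Rightarrow> bool" where
  "is_moore_penrose A X \<longleftrightarrow>
     A ** X ** A = A \<and>
     X ** A ** X = X \<and>
     adjoint_matrix (A ** X) = A ** X \<and>
     adjoint_matrix (X ** A) = X ** A"

definition pinv :: "'a::conjugatable_field^'n^'m \<Rightarrow> 'a^'m^'n" where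
  "pinv A = (THE X. is_moore_penrose A X)"

text \<open>
  An index list of length \<open>CARD('t)\<close> with entries in \<open>'m\<close> is a function \<open>'t \<Rightarrow> 'm\<close> on a
  finite type. It need not be injective, so repetitions are allowed, and it is nonempty
  because types are.
\<close>

definition select_rows :: "'a^'n^'m \<Rightarrow> ('t \<Rightarrow> 'm) \<Rightarrow> 'a^'n^'t" where
  "select_rows A I = (\<chi> a. A $ I a)"

definition select_columns :: "'a^'n^'m \<Rightarrow> ('s \<Rightarrow> 'n) \<Rightarrow> 'a^'s^'m" where
  "select_columns A J = (\<chi> i b. A $ i $ J b)"

definition select_entries :: "'a^'n^'m \<Rightarrow> ('t \<Rightarrow> 'm) \<Rightarrow> ('s \<Rightarrow> 'n) \<Rightarrow> 'a^'s^'t" where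
  "select_entries A I J = (\<chi> a b. A $ I a $ J b)"

text \<open>
  The following facts show that the description in \<^const>\<open>pinv\<close> is proper: every matrix
  over the reals or the complex numbers has exactly one Moore--Penrose inverse.
\<close>

lemma adjoint_matrix_mult:
  fixes A :: "'a::conjugatable_field^'n::finite^'m" and B :: "'a^'k^'n"
  shows "adjoint_matrix (A ** B) = adjoint_matrix B ** adjoint_matrix A"
  by (simp add: adjoint_matrix_def matrix_matrix_mult_def vec_eq_iff sum_conjugate
      conjugate_dist_mul mult.commute)

lemma adjoint_matrix_adjoint [simp]:
  fixes A :: "'a::conjugatable_field^'n^'m"
  shows "adjoint_matrix (adjoint_matrix A) = A"
  by (simp add: adjoint_matrix_def vec_eq_iff)

lemma is_moore_penrose_unique:
  fixes A :: "'a::conjugatable_field^'n::finite^'m::finite"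
  assumes X: "is_moore_penrose A X" and Y: "is_moore_penrose A Y"
  shows "X = Y"
proof -
  have AX: "A ** X = A ** Y"
  proof -
    have "A ** X = adjoint_matrix ((A ** Y) ** (A ** X))"
      using X Y by (simp add: is_moore_penrose_def matrix_mul_assoc)
    also have "\<dots> = (A ** X) ** (A ** Y)"
      using X Y by (simp only: adjoint_matrix_mult[of "A ** Y" "A ** X"] is_moore_penrose_def)
    also have "\<dots> = A ** Y"
      using X by (simp add: is_moore_penrose_def matrix_mul_assoc)
    finally show ?thesis .
  qed
  have XA: "X ** A = Y ** A"
  proof -
    have e: "(X ** A) ** (Y ** A) = X ** A"
      using Y by (metis is_moore_penrose_def matrix_mul_assoc)
    have "X ** A = adjoint_matrix ((X ** A) ** (Y ** A))"
      using X by (simp add: e is_moore_penrose_def)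
    also have "\<dots> = (Y ** A) ** (X ** A)"
      using X Y by (simp only: adjoint_matrix_mult[of "X ** A" "Y ** A"] is_moore_penrose_def)
    also have "\<dots> = Y ** A"
      using X by (metis is_moore_penrose_def matrix_mul_assoc)
    finally show ?thesis .
  qed
  have "X = X ** A ** X" using X by (simp add: is_moore_penrose_def)
  also have "\<dots> = Y ** A ** Y" by (metis AX XA matrix_mul_assoc)
  also have "\<dots> = Y" using Y by (simp add: is_moore_penrose_def)
  finally show ?thesis .
qed

lemma adjoint_matrix_self_mult_eq_0:
  fixes A :: "'a::conjugatable_ordered_field^'n::finite^'m::finite"
  assumes "adjoint_matrix A ** A = 0"
  shows "A = 0"
proof -
  have "A $ i $ j = 0" for i j
  proof -
    have "(\<Sum>k\<in>UNIV. A $ k $ j * conjugate (A $ k $ j)) = (adjoint_matrix A ** A) $ j $ j"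
      by (simp add: adjoint_matrix_def matrix_matrix_mult_def mult.commute)
    then have "(\<Sum>k\<in>UNIV. A $ k $ j * conjugate (A $ k $ j)) = 0"
      using assms by simp
    then have "A $ i $ j * conjugate (A $ i $ j) = 0"
      using sum_nonneg_eq_0_iff[of UNIV "\<lambda>k. A $ k $ j * conjugate (A $ k $ j)"]
      by (auto simp: conjugate_square_positive)
    then show ?thesis by simp
  qed
  then show ?thesis by (simp add: vec_eq_iff)
qed

lemma inner_inverse_exists:
  fixes A :: "'a::field^'n::finite^'m::finite"
  shows "\<exists>G. A ** G ** A = A"
proof -
  obtain B where B: "B \<subseteq> range ((*v) A)" "vec.independent B" "range ((*v) A) \<subseteq> vec.span B"
    by (metis vec.basis_exists)
  define g where "g = vec.construct B (\<lambda>b. SOME x. A *v x = b)"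
  have g: "Vector_Spaces.linear (*s) (*s) g"
    unfolding g_def by (rule vec.linear_construct[OF B(2)])
  have gB: "A *v g b = b" if "b \<in> B" for b
    using that B(1) unfolding g_def vec.construct_basis[OF B(2) that]
    by (metis (mono_tags, lifting) rangeE someI subsetD)
  have gA: "A *v g y = y" if "y \<in> vec.span B" for y
  proof -
    have "Vector_Spaces.linear (*s) (*s) (\<lambda>y. A *v g y)"
      using Vector_Spaces.linear_compose[OF g matrix_vector_mul_linear_gen[of A]]
      by (simp add: o_def)
    from vec.linear_eq_on[OF this vec.linear_id that] gB show ?thesis by simp
  qed
  have "(A ** matrix g ** A) *v x = A *v x" for x
    using gA B(3) matrix_works[OF g] by (auto simp flip: matrix_vector_mul_assoc)
  then show ?thesis by (metis matrix_eq)
qed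

lemma matrix_mult_diff_right:
  fixes A :: "'a::ring_1^'n::finite^'m"
  shows "A ** (B - C) = A ** B - A ** C"
  by (simp add: matrix_matrix_mult_def vec_eq_iff algebra_simps sum_subtractf)

lemma weak_inverse_exists:
  fixes A :: "'a::conjugatable_ordered_field^'n::finite^'m::finite"
  shows "\<exists>X. A ** X ** A = A \<and> adjoint_matrix (A ** X) = A ** X"
proof -
  let ?S = "adjoint_matrix A"
  obtain G where G: "(?S ** A) ** G ** (?S ** A) = ?S ** A"
    using inner_inverse_exists by blast
  let ?P = "A ** (G ** ?S)"
  have "adjoint_matrix (?P ** A - A) ** (?P ** A - A) = 0"
  proof -
    have z: "?S ** (?P ** A - A) = 0"
      using G by (simp add: matrix_mul_assoc matrix_mult_diff_right)
    have "?P ** A - A = A ** (G ** ?S ** A - mat 1)"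
      by (simp add: matrix_mul_assoc matrix_mult_diff_right)
    then have "adjoint_matrix (?P ** A - A) = adjoint_matrix (G ** ?S ** A - mat 1) ** ?S"
      by (simp add: adjoint_matrix_mult)
    then show ?thesis
      by (metis z matrix_mul_assoc times0_right)
  qed
  then have PA: "?P ** A = A"
    using adjoint_matrix_self_mult_eq_0 by fastforce
  have "?P ** adjoint_matrix ?P = adjoint_matrix ?P"
    using PA by (simp add: adjoint_matrix_mult matrix_mul_assoc)
  then have "adjoint_matrix ?P = ?P"
    by (metis adjoint_matrix_adjoint adjoint_matrix_mult)
  with PA show ?thesis by blast
qed

lemma is_moore_penrose_exists:
  fixes A :: "'a::conjugatable_ordered_field^'n::finite^'m::finite"
  shows "\<exists>X. is_moore_penrose A X"
proof -
  obtain X where X: "A ** X ** A = A" "adjoint_matrix (A ** X) = A ** X"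
    using weak_inverse_exists by blast
  obtain Z where Z: "adjoint_matrix A ** Z ** adjoint_matrix A = adjoint_matrix A"
      "adjoint_matrix (adjoint_matrix A ** Z) = adjoint_matrix A ** Z"
    using weak_inverse_exists by blast
  define Y where "Y = adjoint_matrix Z"
  have Y: "A ** Y ** A = A" "adjoint_matrix (Y ** A) = Y ** A"
    using arg_cong[OF Z(1), of adjoint_matrix] Z(2)
    by (simp_all add: Y_def adjoint_matrix_mult matrix_mul_assoc)
  have 1: "A ** (Y ** A ** X) = A ** X" using Y(1) by (simp add: matrix_mul_assoc)
  have 2: "(Y ** A ** X) ** A = Y ** A" using X(1) by (metis matrix_mul_assoc)
  have 3: "(Y ** A) ** (Y ** A ** X) = Y ** A ** X" using Y(1) by (metis matrix_mul_assoc)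
  show ?thesis
    using X Y 1 2 3 unfolding is_moore_penrose_def by metis
qed

lemma is_moore_penrose_pinv:
  fixes A :: "'a::conjugatable_ordered_field^'n::finite^'m::finite"
  shows "is_moore_penrose A (pinv A)"
  unfolding pinv_def using is_moore_penrose_exists is_moore_penrose_unique by (metis theI)

end

theory Submission
  imports Defs
begin

text \<open>
  Write \<open>C = A ** S\<close>, \<open>R = P ** A\<close> and \<open>U = P ** A ** S\<close> with selection matrices \<open>P\<close> and
  \<open>S\<close>. If \<open>rank C = rank R = rank A\<close>, then \<open>A\<close> has the same column space as \<open>C\<close> and the
  same row space as \<open>R\<close>, so the orthogonal projections \<open>C ** pinv C\<close> and \<open>pinv R ** R\<close> fix
  \<open>A\<close>; the Penrose equations for \<open>pinv U\<close> and \<open>pinv A\<close> then follow by cancellation. Conversely,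
  each of the identities writes \<open>A\<close> or \<open>pinv A\<close> as a product with a factor of small rank.
\<close>

section \<open>Row spaces and ranks of products over a field\<close>

lemma row_matrix_mult: "row i (A ** B) = row i A v* B"
  for A :: "'a::field^'n::finite^'m" and B :: "'a^'k^'n"
  by (simp add: row_def matrix_matrix_mult_def vector_matrix_mult_def vec_eq_iff mult.commute)

lemma vector_matrix_mult_in_span_rows: "x v* A \<in> vec.span (rows A)"
  for A :: "'a::field^'n::finite^'m::finite"
  using matrix_vector_mult_in_columnspace_gen[of "transpose A" x]
  by (simp add: columns_transpose)

lemma linear_vector_matrix_mult: "Vector_Spaces.linear (*s) (*s) (\<lambda>x. x v* A)"
  for A :: "'a::field^'n::finite^'m::finite"
  unfolding transpose_matrix_vector[symmetric] by (rule matrix_vector_mul_linear_gen)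

lemma in_span_rowsE:
  fixes A :: "'a::field^'n::finite^'m::finite"
  assumes "y \<in> vec.span (rows A)"
  obtains x where "y = x v* A"
proof -
  have "rows A \<subseteq> range (\<lambda>x. x v* A)"
  proof
    fix y assume "y \<in> rows A"
    then obtain i where "y = row i A" by (auto simp: rows_def)
    \<comment> \<open>The preimage is the \<open>i\<close>-th unit vector, read off from the
      identity matrix.\<close>
    then have "y = row i (mat 1) v* A"
      by (simp flip: row_matrix_mult)
    then show "y \<in> range (\<lambda>x. x v* A)" by blast
  qed
  moreover have "vec.subspace (range (\<lambda>x. x v* A))"
    using linear_vector_matrix_mult vec.subspace_UNIV by (rule vec.linear_subspace_image)
  ultimately have "vec.span (rows A) \<subseteq> range (\<lambda>x. x v* A)"
    by (rule vec.span_minimal)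
  with assms that show thesis by blast
qed

lemma span_rows_mult_subset: "vec.span (rows (P ** A)) \<subseteq> vec.span (rows A)"
  for A :: "'a::field^'n::finite^'m::finite" and P :: "'a^'m^'k::finite"
proof (rule vec.span_minimal)
  show "rows (P ** A) \<subseteq> vec.span (rows A)"
    using vector_matrix_mult_in_span_rows by (fastforce simp: rows_def[of "P ** A"] row_matrix_mult)
qed (rule vec.subspace_span)

lemma rank_mult_le_right: "rank (P ** A) \<le> rank A"
  for A :: "'a::field^'n::finite^'m::finite" and P :: "'a^'m^'k::finite"
  unfolding row_rank_def_gen
  using span_rows_mult_subset[of P A] by (metis vec.dim_span vec.dim_subset)

text \<open>The linear map \<open>x \<mapsto> x v* B\<close> sends the rows of \<open>A\<close> onto
  those of \<open>A ** B\<close>, and a linear map does not raise dimension.\<close>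

lemma rank_mult_le_left: "rank (A ** B) \<le> rank A"
  for A :: "'a::field^'n::finite^'m::finite" and B :: "'a^'k::finite^'n"
proof -
  have "rows (A ** B) = (\<lambda>x. x v* B) ` rows A"
    by (auto simp: rows_def row_matrix_mult)
  then show ?thesis
    unfolding row_rank_def_gen
    by (simp add: vec.dim_image_le[OF linear_vector_matrix_mult])
qed

lemma rank_mult_le_middle: "rank (P ** A ** B) \<le> rank A"
  for A :: "'a::field^'n::finite^'m::finite" and P :: "'a^'m^'k::finite" and B :: "'a^'l::finite^'n"
  using rank_mult_le_left rank_mult_le_right by (rule order_trans)

text \<open>Equal dimension forces the nested row spaces to coincide. Each row of \<open>A\<close>
  is then a combination of rows of \<open>P ** A\<close>, and the coefficient vectors form the rows
  of \<open>W\<close>.\<close>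

lemma left_factor_of_rank_eq:
  fixes A :: "'a::field^'n::finite^'m::finite" and P :: "'a^'m^'k::finite"
  assumes "rank (P ** A) = rank A"
  obtains W where "A = W ** (P ** A)"
proof -
  have "vec.span (rows (P ** A)) = vec.span (rows A)"
    using assms span_rows_mult_subset[of P A]
    by (intro vec.subspace_dim_equal) (auto simp: row_rank_def_gen vec.subspace_span)
  then have "row i A \<in> vec.span (rows (P ** A))" for i
    by (auto simp: rows_def intro: vec.span_base)
  then have "\<exists>w. row i A = w v* (P ** A)" for i
    by (metis in_span_rowsE)
  then obtain w where "\<And>i. row i A = w i v* (P ** A)" by metis
  then have "row i A = row i ((\<chi> i. w i) ** (P ** A))" for i
    by (simp add: row_matrix_mult) (simp add: row_def)
  then have "A = (\<chi> i. w i) ** (P ** A)"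
    by (simp add: row_def vec_eq_iff)
  then show thesis by (rule that)
qed

section \<open>Penrose equations, ranks of pseudoinverse and adjoint\<close>

context
  fixes A :: "'a::conjugatable_ordered_field^'n::finite^'m::finite"
begin

lemma mult_pinv_mult: "A ** pinv A ** A = A"
  and pinv_mult_pinv: "pinv A ** A ** pinv A = pinv A"
  and adjoint_mult_pinv: "adjoint_matrix (A ** pinv A) = A ** pinv A"
  and adjoint_pinv_mult: "adjoint_matrix (pinv A ** A) = pinv A ** A"
  using is_moore_penrose_pinv[of A] by (auto simp: is_moore_penrose_def)

end

lemma pinv_eqI: "is_moore_penrose A X \<Longrightarrow> pinv A = X"
  for A :: "'a::conjugatable_ordered_field^'n::finite^'m::finite"
  using is_moore_penrose_pinv is_moore_penrose_unique by blast

text \<open>The first two Penrose equations write each of \<open>A\<close> and \<open>pinv A\<close>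
  as a product with the other in the middle.\<close>

lemma rank_pinv: "rank (pinv A) = rank A"
  for A :: "'a::conjugatable_ordered_field^'n::finite^'m::finite"
  using rank_mult_le_middle[of A "pinv A" A] rank_mult_le_middle[of "pinv A" A "pinv A"]
  by (simp add: mult_pinv_mult pinv_mult_pinv)

text \<open>Since \<open>pinv B ** B\<close> is self-adjoint, \<open>B = B ** pinv B ** B\<close>
  can be rewritten with \<open>adjoint_matrix B\<close> as a middle factor. Using this for
  \<open>A\<close> and for its adjoint gives both inequalities.\<close>

lemma rank_adjoint_matrix: "rank (adjoint_matrix A) = rank A"
  for A :: "'a::conjugatable_ordered_field^'n::finite^'m::finite"
proof -
  have le: "rank B \<le> rank (adjoint_matrix B)"
    for B :: "'a^'p::finite^'q::finite"
  proof -
    have "B = B ** (pinv B ** B)"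
      by (simp add: matrix_mul_assoc mult_pinv_mult)
    also have "\<dots> = B ** adjoint_matrix B ** adjoint_matrix (pinv B)"
      by (subst adjoint_pinv_mult[symmetric]) (simp add: adjoint_matrix_mult matrix_mul_assoc)
    finally have "B = B ** adjoint_matrix B ** adjoint_matrix (pinv B)" .
    then show ?thesis
      by (metis rank_mult_le_middle)
  qed
  from le[of A] le[of "adjoint_matrix A"] show ?thesis by simp
qed

text \<open>Passing to adjoints preserves rank and reverses products, which reduces this to the row
  version.\<close>

lemma right_factor_of_rank_eq:
  fixes A :: "'a::conjugatable_ordered_field^'n::finite^'m::finite" and S :: "'a^'k::finite^'n"
  assumes "rank (A ** S) = rank A"
  obtains Z where "A = A ** S ** Z"
proof -
  have "rank (adjoint_matrix S ** adjoint_matrix A) = rank (adjoint_matrix A)"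
    using assms by (simp add: rank_adjoint_matrix flip: adjoint_matrix_mult)
  then obtain W where "adjoint_matrix A = W ** (adjoint_matrix S ** adjoint_matrix A)"
    by (rule left_factor_of_rank_eq)
  then have "A = A ** S ** adjoint_matrix W"
    by (metis adjoint_matrix_adjoint adjoint_matrix_mult)
  then show thesis by (rule that)
qed

section \<open>Projections fixing the matrix, and the CUR identities\<close>

text \<open>Once \<open>A = W ** R\<close> with \<open>R = P ** A\<close>, this is
  \<open>R ** pinv R ** R = R\<close> multiplied by \<open>W\<close> on the left.\<close>

lemma pinv_right_projection_of_rank_eq:
  fixes A :: "'a::conjugatable_ordered_field^'n::finite^'m::finite" and P :: "'a^'m^'t::finite"
  assumes "rank (P ** A) = rank A"
  shows "A ** pinv (P ** A) ** (P ** A) = A"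
proof -
  obtain W where "A = W ** (P ** A)"
    using assms by (rule left_factor_of_rank_eq)
  moreover have "W ** (P ** A) ** pinv (P ** A) ** (P ** A)
      = W ** (P ** A ** pinv (P ** A) ** (P ** A))"
    by (simp only: matrix_mul_assoc)
  ultimately show ?thesis
    by (metis mult_pinv_mult)
qed

lemma pinv_left_projection_of_rank_eq:
  fixes A :: "'a::conjugatable_ordered_field^'n::finite^'m::finite" and S :: "'a^'s::finite^'n"
  assumes "rank (A ** S) = rank A"
  shows "A ** S ** pinv (A ** S) ** A = A"
proof -
  obtain Z where "A = A ** S ** Z"
    using assms by (rule right_factor_of_rank_eq)
  moreover have "A ** S ** pinv (A ** S) ** (A ** S ** Z)
      = A ** S ** pinv (A ** S) ** (A ** S) ** Z"
    by (simp only: matrix_mul_assoc)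
  ultimately show ?thesis
    by (metis mult_pinv_mult)
qed

lemma cur_of_rank_eq:
  fixes A :: "'a::conjugatable_ordered_field^'n::finite^'m::finite"
    and P :: "'a^'m^'t::finite" and S :: "'a^'s::finite^'n"
  defines "C \<equiv> A ** S" and "R \<equiv> P ** A" and "U \<equiv> P ** A ** S"
  assumes "rank C = rank A" and "rank R = rank A"
  shows "rank U = rank A" and "A = C ** pinv U ** R"
    and "A = C ** pinv C ** A ** pinv R ** R"
    and "pinv A = pinv R ** U ** pinv C" and "pinv U = pinv C ** A ** pinv R"
proof -
  have CA: "C ** pinv C ** A = A" and AR: "A ** pinv R ** R = A"
    using assms pinv_left_projection_of_rank_eq pinv_right_projection_of_rank_eq by blast+
  \<comment> \<open>Multiplying the two fixing identities by \<open>P\<close> on the left and by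
    \<open>S\<close> on the right brings in \<open>U\<close>.\<close>
  have UC: "U ** pinv C ** A = R"
    using arg_cong[OF CA, of "(**) P"] by (simp add: C_def R_def U_def matrix_mul_assoc)
  have RU: "A ** pinv R ** U = C"
    using arg_cong[OF AR, of "\<lambda>X. X ** S"] by (simp add: C_def R_def U_def matrix_mul_assoc)
  show "A = C ** pinv C ** A ** pinv R ** R"
    using CA AR by simp
  \<comment> \<open>Both products of \<open>U\<close> with the candidate collapse to projections
    already known to be self-adjoint, so only the first two Penrose equations remain.\<close>
  have UX: "U ** (pinv C ** A ** pinv R) = R ** pinv R"
    and XU: "pinv C ** A ** pinv R ** U = pinv C ** C"
    using UC arg_cong[OF RU, of "(**) (pinv C)"] by (simp_all add: matrix_mul_assoc)
  show pinv_U: "pinv U = pinv C ** A ** pinv R"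
  proof (rule pinv_eqI, unfold is_moore_penrose_def, intro conjI)
    show "U ** (pinv C ** A ** pinv R) ** U = U"
      unfolding UX using arg_cong[OF mult_pinv_mult[of R], of "\<lambda>X. X ** S"]
      by (simp add: R_def U_def matrix_mul_assoc)
    show "pinv C ** A ** pinv R ** U ** (pinv C ** A ** pinv R) = pinv C ** A ** pinv R"
      unfolding XU by (simp add: matrix_mul_assoc pinv_mult_pinv)
  qed (simp_all add: UX XU adjoint_mult_pinv adjoint_pinv_mult)
  show "A = C ** pinv U ** R"
    unfolding pinv_U using CA AR by (simp add: matrix_mul_assoc)
  \<comment> \<open>The same collapse, now for the candidate pseudoinverse of
    \<open>A\<close>.\<close>
  have AY: "A ** (pinv R ** U ** pinv C) = C ** pinv C"
    and YA: "pinv R ** U ** pinv C ** A = pinv R ** R"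
    using RU arg_cong[OF UC, of "(**) (pinv R)"] by (simp_all add: matrix_mul_assoc)
  show "pinv A = pinv R ** U ** pinv C"
  proof (rule pinv_eqI, unfold is_moore_penrose_def, intro conjI)
    show "A ** (pinv R ** U ** pinv C) ** A = A"
      unfolding AY by (rule CA)
    show "pinv R ** U ** pinv C ** A ** (pinv R ** U ** pinv C) = pinv R ** U ** pinv C"
      unfolding YA by (simp add: matrix_mul_assoc pinv_mult_pinv)
  qed (simp_all add: AY YA adjoint_mult_pinv adjoint_pinv_mult)
  \<comment> \<open>By \<open>RU\<close>, the matrix \<open>C\<close> is a left multiple of
    \<open>U\<close>.\<close>
  have "rank C \<le> rank U"
    using RU rank_mult_le_right by metis
  then show "rank U = rank A"
    using assms(4) rank_mult_le_left[of R S] \<open>rank R = rank A\<close>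
    by (simp add: U_def R_def)
qed

text \<open>Supplies the converse directions: a product has rank at most that of any factor, and
  \<open>pinv\<close> preserves rank.\<close>

lemma rank_le_of_cur:
  fixes A :: "'a::conjugatable_ordered_field^'n::finite^'m::finite"
    and C :: "'a^'s::finite^'m" and U :: "'a^'s^'t::finite" and R :: "'a^'n^'t"
  shows "A = C ** pinv U ** R \<Longrightarrow> rank A \<le> rank U"
    and "A = C ** pinv C ** A ** pinv R ** R \<Longrightarrow> rank A \<le> rank C \<and> rank A \<le> rank R"
    and "pinv A = pinv R ** U ** pinv C \<Longrightarrow> rank A \<le> rank U"
proof -
  assume "A = C ** pinv U ** R"
  then show "rank A \<le> rank U"
    by (metis rank_pinv rank_mult_le_middle)
next
  assume "A = C ** pinv C ** A ** pinv R ** R"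
  then show "rank A \<le> rank C \<and> rank A \<le> rank R"
    using rank_mult_le_left[of C "pinv C ** A ** pinv R ** R"]
      rank_mult_le_right[of "C ** pinv C ** A ** pinv R" R]
    by (simp add: matrix_mul_assoc)
next
  assume "pinv A = pinv R ** U ** pinv C"
  then show "rank A \<le> rank U"
    by (metis rank_pinv rank_mult_le_middle)
qed

section \<open>Selection as multiplication, and the equivalences\<close>

lemma select_rows_eq_mult: "select_rows A I = select_rows (mat 1) I ** A"
  for A :: "'a::field^'n::finite^'m::finite" and I :: "'t::finite \<Rightarrow> 'm"
  by (simp add: select_rows_def matrix_matrix_mult_def mat_def vec_eq_iff if_distrib if_distribR
      cong: if_cong)

lemma select_columns_eq_mult: "select_columns A J = A ** select_columns (mat 1) J"
  for A :: "'a::field^'n::finite^'m::finite" and J :: "'s::finite \<Rightarrow> 'n"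
  by (simp add: select_columns_def matrix_matrix_mult_def mat_def vec_eq_iff if_distrib if_distribR
      cong: if_cong)

lemma select_entries_eq: "select_entries A I J = select_columns (select_rows A I) J"
  by (simp add: select_entries_def select_columns_def select_rows_def)

lemma cur_equivalences:
  fixes A :: "'a::conjugatable_ordered_field^'n::finite^'m::finite"
    and I :: "'t::finite \<Rightarrow> 'm" and J :: "'s::finite \<Rightarrow> 'n"
  shows
    "let C = select_columns A J; R = select_rows A I; U = select_entries A I J;
         c1 = (rank U = rank A);
         c2 = (A = C ** pinv U ** R);
         c3 = (A = C ** pinv C ** A ** pinv R ** R);
         c4 = (pinv A = pinv R ** U ** pinv C);
         c5 = (rank C = rank R \<and> rank R = rank A)
     in (c1 \<longleftrightarrow> c2) \<and> (c1 \<longleftrightarrow> c3) \<and> (c1 \<longleftrightarrow> c4) \<and> (c1 \<longleftrightarrow> c5) \<and>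
        (c1 \<or> c2 \<or> c3 \<or> c4 \<or> c5 \<longrightarrow> pinv U = pinv C ** A ** pinv R)"
proof -
  define P :: "'a^'m^'t" where "P = select_rows (mat 1) I"
  define S :: "'a^'s^'n" where "S = select_columns (mat 1) J"
  define C where "C = select_columns A J"
  define R where "R = select_rows A I"
  define U where "U = select_entries A I J"
  have C: "C = A ** S" and R: "R = P ** A" and U: "U = P ** A ** S"
    using select_columns_eq_mult[of A J] select_rows_eq_mult[of A I]
      select_columns_eq_mult[of R J]
    by (simp_all add: C_def R_def U_def P_def S_def select_entries_eq)
  \<comment> \<open>\<open>U\<close> is a left multiple of \<open>C\<close> and a right multiple of
    \<open>R\<close>, according to the bracketing of \<open>P ** A ** S\<close>.\<close>
  have le: "rank C \<le> rank A" "rank R \<le> rank A" "rank U \<le> rank C" "rank U \<le> rank R"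
    by (simp_all add: C R U rank_mult_le_left rank_mult_le_right flip: matrix_mul_assoc)
       (simp add: matrix_mul_assoc rank_mult_le_left)
  note cur = cur_of_rank_eq[where A = A and P = P and S = S, folded U, folded R C]
  \<comment> \<open>Condition \<open>c5\<close> serves as the hub: each of the others is shown
    equivalent to it. The converses squeeze \<open>rank C\<close> and \<open>rank R\<close> between
    \<open>rank A\<close> and itself, through \<open>rank U\<close> where it occurs.\<close>
  have "rank U = rank A \<longleftrightarrow> rank C = rank A \<and> rank R = rank A"
    using le cur(1) by linarith
  moreover have "A = C ** pinv U ** R \<longleftrightarrow> rank C = rank A \<and> rank R = rank A"
    using le cur(2) rank_le_of_cur(1)[of A C U R] by (meson order_antisym order_trans)
  moreover have "A = C ** pinv C ** A ** pinv R ** R \<longleftrightarrow> rank C = rank A \<and> rank R = rank A"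
    using le cur(3) rank_le_of_cur(2)[of A C R] by (meson order_antisym order_trans)
  moreover have "pinv A = pinv R ** U ** pinv C \<longleftrightarrow> rank C = rank A \<and> rank R = rank A"
    using le cur(4) rank_le_of_cur(3)[of A R U C] by (meson order_antisym order_trans)
  ultimately show ?thesis
    unfolding Let_def C_def[symmetric] R_def[symmetric] U_def[symmetric]
    using cur(5) by metis
qed

theorem theorem1:
  fixes A :: "real^'n^'m" and A' :: "complex^'n^'m"
    and I :: "'t::finite \<Rightarrow> 'm" and J :: "'s::finite \<Rightarrow> 'n"
  shows
    "(let C = select_columns A J; R = select_rows A I; U = select_entries A I J;
           c1 = (rank U = rank A);
           c2 = (A = C ** pinv U ** R);
           c3 = (A = C ** pinv C ** A ** pinv R ** R);
           c4 = (pinv A = pinv R ** U ** pinv C);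
           c5 = (rank C = rank R \<and> rank R = rank A)
       in (c1 \<longleftrightarrow> c2) \<and> (c1 \<longleftrightarrow> c3) \<and> (c1 \<longleftrightarrow> c4) \<and> (c1 \<longleftrightarrow> c5) \<and>
          (c1 \<or> c2 \<or> c3 \<or> c4 \<or> c5 \<longrightarrow> pinv U = pinv C ** A ** pinv R))
     \<and>
     (let C = select_columns A' J; R = select_rows A' I; U = select_entries A' I J;
           c1 = (rank U = rank A');
           c2 = (A' = C ** pinv U ** R);
           c3 = (A' = C ** pinv C ** A' ** pinv R ** R);
           c4 = (pinv A' = pinv R ** U ** pinv C);
           c5 = (rank C = rank R \<and> rank R = rank A')
       in (c1 \<longleftrightarrow> c2) \<and> (c1 \<longleftrightarrow> c3) \<and> (c1 \<longleftrightarrow> c4) \<and> (c1 \<longleftrightarrow> c5) \<and>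
          (c1 \<or> c2 \<or> c3 \<or> c4 \<or> c5 \<longrightarrow> pinv U = pinv C ** A' ** pinv R))"
  \<comment> \<open>Both \<open>real\<close> and \<open>complex\<close> are instances of
    \<open>conjugatable_ordered_field\<close>.\<close>
  by (intro conjI cur_equivalences)

end
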